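(* For every positive integer $n$, the group $T(n,\mathbb{Z})$ of invertible upper triangular $n\times n$ matrices over $\mathbb{Z}$ is graph automatic.
   Context: $T(n,\mathbb{Z})$ is the group under matrix multiplication of all $n\times n$ integer matrices that have all entries below the main diagonal equal to zero and are invertible over $\mathbb{Z}$. For a finite alphabet $\Sigma$, let $\Sigma^\star$ be the set of finite strings over $\Sigma$. For strings $w_1,\dots,w_n\in\Sigma^\star$ the convolution $\otimes(w_1,\dots,w_n)$ is the string of length $\max_i|w_i|$ over the alphabet $(\Sigma\cup\{\diamond\})^n$ (with $\diamond\notin\Sigma$) whose $k$-th symbol is $(\sigma_1,\dots,\sigma_n)$, where $\sigma_i$ is the $k$-th symbol of $w_i$ if $k\le|w_i|$ and $\sigma_i=\diamond$ otherwise. A relation $R\subseteq(\Sigma^\star)^n$ is FA recognizable if $\{\otimes(w_1,\dots,w_n)\mid (w_1,\dots,w_n)\in R\}$ is a regular language (recognized by a finite automaton). Let $G$ be a group generated by a finite set $X$. Its Cayley graph $\Gamma(G,X)$ is viewed as the structure $(G;(E_x)_{x\in X})$ with $E_x=\{(g,gx)\mid g\in G\}$. The group $G$ is graph automatic with respect to $X$ if there are a finite alphabet $\Sigma$, a regular language $R\subseteq\Sigma^\star$ and a bijection $\nu:R\to G$ such that for each $x\in X$ the relation $\{(u,v)\in R^2\mid \nu(u)x=\nu(v)\}$ is FA recognizable. A finitely generated group is graph automatic if it is graph automatic with respect to some finite generating set. *)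

theory Defs
  imports "Jordan_Normal_Form.Matrix" "HOL-Algebra.Generated_Groups"
begin

record ('q, 'a) dfa =
  states :: "'q set"
  initial :: 'q
  trans :: "'q \<Rightarrow> 'a \<Rightarrow> 'q"
  accepting :: "'q set"

definition is_dfa :: "'a set \<Rightarrow> ('q, 'a) dfa \<Rightarrow> bool" where
  "is_dfa \<Sigma> M \<longleftrightarrow> finite \<Sigma> \<and> finite (states M) \<and> initial M \<in> states M \<and>
     accepting M \<subseteq> states M \<and> (\<forall>q\<in>states M. \<forall>a\<in>\<Sigma>. trans M q a \<in> states M)"

definition dfa_language :: "'a set \<Rightarrow> ('q, 'a) dfa \<Rightarrow> 'a list set" where
  "dfa_language \<Sigma> M = {w \<in> lists \<Sigma>. foldl (trans M) (initial M) w \<in> accepting M}"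

text \<open>Taking states of type \<^typ>\<open>nat\<close> is no restriction, since state sets are finite.\<close>

definition regular_language :: "'a set \<Rightarrow> 'a list set \<Rightarrow> bool" where
  "regular_language \<Sigma> L \<longleftrightarrow> (\<exists>M :: (nat, 'a) dfa. is_dfa \<Sigma> M \<and> L = dfa_language \<Sigma> M)"

text \<open>An \<open>n\<close>-tuple is a list of length \<open>n\<close>; the padding symbol is \<^const>\<open>None\<close>, and
  a symbol \<open>a\<close> of the original alphabet becomes \<open>Some a\<close>.\<close>

definition padded_symbol :: "nat \<Rightarrow> 'a list \<Rightarrow> 'a option" where
  "padded_symbol k w = (if k < length w then Some (w ! k) else None)"

definition convolution :: "'a list list \<Rightarrow> 'a option list list" where
  "convolution ws =
     map (\<lambda>k. map (padded_symbol k) ws) [0..<Max (insert 0 (length ` set ws))]"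

definition convolution_alphabet :: "'a set \<Rightarrow> nat \<Rightarrow> 'a option list set" where
  "convolution_alphabet \<Sigma> n = {s. length s = n \<and> set s \<subseteq> insert None (Some ` \<Sigma>)}"

definition fa_recognizable :: "'a set \<Rightarrow> nat \<Rightarrow> 'a list list set \<Rightarrow> bool" where
  "fa_recognizable \<Sigma> n R \<longleftrightarrow>
     R \<subseteq> {ws. length ws = n \<and> set ws \<subseteq> lists \<Sigma>} \<and>
     regular_language (convolution_alphabet \<Sigma> n) (convolution ` R)"

text \<open>Letters of type \<^typ>\<open>nat\<close> are no restriction, since alphabets are finite.\<close>

definition graph_automatic_wrt :: "('g, 'm) monoid_scheme \<Rightarrow> 'g set \<Rightarrow> bool" where
  "graph_automatic_wrt G X \<longleftrightarrow>
     (\<exists>(\<Sigma> :: nat set) (R :: nat list set) (\<nu> :: nat list \<Rightarrow> 'g).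
        finite \<Sigma> \<and> regular_language \<Sigma> R \<and> bij_betw \<nu> R (carrier G) \<and>
        (\<forall>x\<in>X. fa_recognizable \<Sigma> 2
           {[u, v] | u v. u \<in> R \<and> v \<in> R \<and> \<nu> u \<otimes>\<^bsub>G\<^esub> x = \<nu> v}))"

definition graph_automatic :: "('g, 'm) monoid_scheme \<Rightarrow> bool" where
  "graph_automatic G \<longleftrightarrow> group G \<and>
     (\<exists>X. finite X \<and> X \<subseteq> carrier G \<and> generate G X = carrier G \<and> graph_automatic_wrt G X)"

text \<open>As the entries are of type \<^typ>\<open>int\<close>, \<^const>\<open>invertible_mat\<close> means
  invertible over the integers.\<close>

definition upper_triangular_group :: "nat \<Rightarrow> int mat monoid" where
  "upper_triangular_group n =
     \<lparr>carrier = {A \<in> carrier_mat n n. upper_triangular A \<and> invertible_mat A},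
      monoid.mult = (*), one = 1\<^sub>m n\<rparr>"

end

theory Submission
  imports Defs "Jordan_Normal_Form.Determinant"
begin

text \<open>Every integer has a unique balanced ternary expansion (digits \<open>-1, 0, 1\<close>) without leading
  zeros. Expanding all entries at once, least significant digit first, a matrix becomes a word whose
  letters are upper triangular digit matrices; unlike sign and magnitude, this needs no extra
  treatment of signs. Right multiplication by a fixed matrix acts linearly on the entries, so
  \<open>A * X = B\<close> is checked by a finite automaton that reads the digits of \<open>A\<close> and \<open>B\<close> in parallel
  and keeps the bounded carries of \<open>A * X - B\<close> in its state. Hence any finite generating set
  will do; row operations show that the matrices with entries in \<open>{-1, 0, 1}\<close> generate.\<close>

subsection \<open>Regular languages\<close>

lemma foldl_in_states:
  "is_dfa \<Sigma> M \<Longrightarrow> q \<in> states M \<Longrightarrow> w \<in> lists \<Sigma> \<Longrightarrow> foldl (trans M) q w \<in> states M"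
  by (induction w arbitrary: q) (auto simp: is_dfa_def)

text \<open>Numbering the finitely many states yields the states of type \<open>nat\<close> that the
  definition asks for. The constructions below are thus free to use pairs, sets and sums as
  states.\<close>

lemma regular_languageI:
  fixes M :: "('q, 'a) dfa"
  assumes M: "is_dfa \<Sigma> M"
  shows "regular_language \<Sigma> (dfa_language \<Sigma> M)"
proof -
  have fin: "finite (states M)" and closed: "\<And>q a. q \<in> states M \<Longrightarrow> a \<in> \<Sigma> \<Longrightarrow> trans M q a \<in> states M"
    using M by (auto simp: is_dfa_def)
  obtain h :: "'q \<Rightarrow> nat" and k where h: "bij_betw h (states M) {..<k}"
    using ex_bij_betw_finite_nat[OF fin] by (auto simp: atLeast0LessThan)
  then have inj: "inj_on h (states M)"
    by (auto simp: bij_betw_def)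
  define r where "r = the_inv_into (states M) h"
  have r: "r (h q) = q" if "q \<in> states M" for q
    using the_inv_into_f_f[OF inj that] by (simp add: r_def)
  define N where "N = \<lparr>states = h ` states M, initial = h (initial M),
    trans = (\<lambda>q a. h (trans M (r q) a)), accepting = h ` accepting M\<rparr>"
  have "is_dfa \<Sigma> N"
    using M by (auto simp: is_dfa_def N_def r)
  moreover have run: "foldl (trans N) (h q) w = h (foldl (trans M) q w)"
    if "q \<in> states M" "w \<in> lists \<Sigma>" for q w
    using that by (induction w arbitrary: q) (auto simp: N_def r closed)
  have "dfa_language \<Sigma> N = dfa_language \<Sigma> M"
  proof -
    have init: "initial M \<in> states M" and acc: "accepting M \<subseteq> states M"
      using M by (auto simp: is_dfa_def)
    have "foldl (trans N) (initial N) w \<in> accepting N \<longleftrightarrow>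
        foldl (trans M) (initial M) w \<in> accepting M" if w: "w \<in> lists \<Sigma>" for w
    proof -
      have "foldl (trans N) (initial N) w = h (foldl (trans M) (initial M) w)"
        using run[OF init w] by (simp add: N_def)
      moreover have "accepting N = h ` accepting M"
        by (simp add: N_def)
      ultimately show ?thesis
        using inj_on_image_mem_iff[OF inj foldl_in_states[OF M init w] acc] by simp
    qed
    then show ?thesis
      by (auto simp: dfa_language_def)
  qed
  ultimately show ?thesis
    unfolding regular_language_def by metis
qed

lemma regular_languageE:
  assumes "regular_language \<Sigma> L"
  obtains M :: "(nat, 'a) dfa" where "is_dfa \<Sigma> M" "L = dfa_language \<Sigma> M"
  using assms unfolding regular_language_def by blast

lemma regular_language_Int:
  assumes "regular_language \<Sigma> K" "regular_language \<Sigma> L"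
  shows "regular_language \<Sigma> (K \<inter> L)"
proof -
  obtain M N :: "(nat, 'a) dfa"
    where M: "is_dfa \<Sigma> M" "K = dfa_language \<Sigma> M" and N: "is_dfa \<Sigma> N" "L = dfa_language \<Sigma> N"
    using assms by (elim regular_languageE)
  define P where "P = \<lparr>states = states M \<times> states N, initial = (initial M, initial N),
    trans = (\<lambda>(p, q) a. (trans M p a, trans N q a)), accepting = accepting M \<times> accepting N\<rparr>"
  have run: "foldl (trans P) (p, q) w = (foldl (trans M) p w, foldl (trans N) q w)" for p q w
    by (induction w arbitrary: p q) (auto simp: P_def)
  have "is_dfa \<Sigma> P"
    using M(1) N(1) by (auto simp: is_dfa_def P_def)
  moreover have "dfa_language \<Sigma> P = K \<inter> L"
    using run[of "initial M" "initial N"] by (auto simp: dfa_language_def M N P_def)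
  ultimately show ?thesis
    using regular_languageI by metis
qed

text \<open>Serves to impose a regular condition on one track of a convolution, with
  \<open>h\<close> the projection to that track.\<close>

lemma regular_language_vimage_map:
  assumes L: "regular_language \<Sigma> L" and fin: "finite \<Delta>" and h: "h ` \<Delta> \<subseteq> \<Sigma>"
  shows "regular_language \<Delta> {w \<in> lists \<Delta>. map h w \<in> L}"
proof -
  obtain M :: "(nat, 'a) dfa" where M: "is_dfa \<Sigma> M" "L = dfa_language \<Sigma> M"
    using L by (elim regular_languageE)
  define N where "N = \<lparr>states = states M, initial = initial M,
    trans = (\<lambda>q a. trans M q (h a)), accepting = accepting M\<rparr>"
  have run: "foldl (trans N) q w = foldl (trans M) q (map h w)" for q w
    by (induction w arbitrary: q) (auto simp: N_def)
  have "is_dfa \<Delta> N"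
    using M(1) fin h by (auto simp: is_dfa_def N_def)
  moreover have "dfa_language \<Delta> N = {w \<in> lists \<Delta>. map h w \<in> L}"
    using h run[of "initial M"] by (fastforce simp: dfa_language_def M N_def lists_eq_set)
  ultimately show ?thesis
    using regular_languageI by metis
qed

lemma regular_language_lists:
  assumes "finite \<Sigma>"
  shows "regular_language \<Sigma> (lists (\<Sigma> \<inter> B))"
proof -
  define M where "M = \<lparr>states = UNIV :: bool set, initial = True,
    trans = (\<lambda>q a. q \<and> a \<in> B), accepting = {True}\<rparr>"
  have run: "foldl (trans M) q w \<longleftrightarrow> q \<and> w \<in> lists B" for q w
    by (induction w arbitrary: q) (auto simp: M_def)
  have "is_dfa \<Sigma> M"
    using assms by (auto simp: is_dfa_def M_def)
  moreover have "dfa_language \<Sigma> M = lists (\<Sigma> \<inter> B)"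
    using run[of True] by (auto simp: dfa_language_def M_def)
  ultimately show ?thesis
    using regular_languageI by metis
qed

lemma regular_language_last:
  assumes "finite \<Sigma>"
  shows "regular_language \<Sigma> {w \<in> lists \<Sigma>. w = [] \<or> last w \<in> B}"
proof -
  \<comment> \<open>The state tells whether the last letter read lies in \<open>B\<close>; starting
    with \<open>True\<close> accepts the empty word.\<close>
  define M where "M = \<lparr>states = UNIV :: bool set, initial = True,
    trans = (\<lambda>q a. a \<in> B), accepting = {True}\<rparr>"
  have run: "foldl (trans M) q w \<longleftrightarrow> (if w = [] then q else last w \<in> B)" for q w
    by (induction w arbitrary: q) (auto simp: M_def)
  have "is_dfa \<Sigma> M"
    using assms by (auto simp: is_dfa_def M_def)
  moreover have "dfa_language \<Sigma> M = {w \<in> lists \<Sigma>. w = [] \<or> last w \<in> B}"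
    using run[of True] by (auto simp: dfa_language_def M_def)
  ultimately show ?thesis
    using regular_languageI by metis
qed

text \<open>This is the shape of a single track of a convolution. The amount of padding is left open
  because it depends on the other word.\<close>

definition padded_words :: "'a list set \<Rightarrow> 'a option list set" where
  "padded_words L = {map Some w @ replicate k None | w k. w \<in> L}"

lemma Nil_in_padded_words_iff: "[] \<in> padded_words L \<longleftrightarrow> [] \<in> L"
  by (auto simp: padded_words_def)

text \<open>The set on the right is the left quotient of \<open>L\<close> by \<open>a\<close>, which
  is what an automaton for \<open>L\<close> still has to accept after a move on
  \<open>a\<close>.\<close>

lemma Some_in_padded_words_iff: "Some a # s \<in> padded_words L \<longleftrightarrow> s \<in> padded_words {w. a # w \<in> L}"
  unfolding padded_words_def
  by (fastforce simp: Cons_eq_append_conv Cons_eq_map_conv Cons_replicate_eq)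

lemma None_in_padded_words_iff: "None # s \<in> padded_words L \<longleftrightarrow> [] \<in> L \<and> set s \<subseteq> {None}"
proof
  assume "None # s \<in> padded_words L"
  then show "[] \<in> L \<and> set s \<subseteq> {None}"
    by (auto simp: padded_words_def Cons_eq_append_conv Cons_eq_map_conv Cons_replicate_eq)
next
  assume asm: "[] \<in> L \<and> set s \<subseteq> {None}"
  then have "None # s = map Some [] @ replicate (Suc (length s)) None"
    by (induction s) auto
  with asm show "None # s \<in> padded_words L"
    unfolding padded_words_def by blast
qed

lemma regular_language_padded_words:
  assumes L: "regular_language \<Sigma> L"
  shows "regular_language (insert None (Some ` \<Sigma>)) (padded_words L)"
proof -
  obtain M :: "(nat, 'a) dfa" where M: "is_dfa \<Sigma> M" "L = dfa_language \<Sigma> M"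
    using L by (elim regular_languageE)
  have fin: "finite \<Sigma>" "finite (states M)"
    using M by (auto simp: is_dfa_def)
  text \<open>The state \<open>Inl q\<close> means that no padding symbol has been read yet, \<open>Inr True\<close> that an
    accepted word has been read and is being padded, and \<open>Inr False\<close> is a sink.\<close>
  define N :: "(nat + bool, 'a option) dfa" where "N = \<lparr>states = states M <+> UNIV, initial = Inl (initial M),
    trans = (\<lambda>q a. case (q, a) of
      (Inl p, Some b) \<Rightarrow> Inl (trans M p b)
    | (Inl p, None) \<Rightarrow> Inr (p \<in> accepting M)
    | (Inr t, Some b) \<Rightarrow> Inr False
    | (Inr t, None) \<Rightarrow> Inr t),
    accepting = insert (Inr True) (Inl ` accepting M)\<rparr>"
  have run_Inr: "foldl (trans N) (Inr t) s = Inr (t \<and> set s \<subseteq> {None})" for t s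
    by (induction s arbitrary: t) (auto simp: N_def split: option.split)
  \<comment> \<open>The claim concerns \<open>M\<close> started in an arbitrary state
    \<open>q\<close>, so that a move on \<open>b\<close> matches the left quotient by
    \<open>b\<close>.\<close>
  have run: "foldl (trans N) (Inl q) s \<in> accepting N \<longleftrightarrow>
      s \<in> padded_words {w \<in> lists \<Sigma>. foldl (trans M) q w \<in> accepting M}"
    if "s \<in> lists (insert None (Some ` \<Sigma>))" for q s
    using that
  proof (induction s arbitrary: q rule: list.induct)
    case Nil
    then show ?case
      by (auto simp: Nil_in_padded_words_iff N_def)
  next
    case (Cons a s)
    show ?case
    proof (cases a)
      case None
      have "foldl (trans N) (Inl q) (a # s) = Inr (q \<in> accepting M \<and> set s \<subseteq> {None})"
        using run_Inr by (simp add: None N_def)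
      moreover have "Inr t \<in> accepting N \<longleftrightarrow> t" for t
        by (auto simp: N_def)
      ultimately show ?thesis
        unfolding None None_in_padded_words_iff by simp
    next
      case (Some b)
      have "foldl (trans N) (Inl q) (a # s) = foldl (trans N) (Inl (trans M q b)) s"
        by (simp add: Some N_def)
      moreover have "b \<in> \<Sigma>"
        using Cons.prems Some by auto
      ultimately show ?thesis
        using Cons unfolding Some by (simp add: Some_in_padded_words_iff)
    qed
  qed
  have "is_dfa (insert None (Some ` \<Sigma>)) N"
    using M(1) by (auto simp: is_dfa_def N_def)
  moreover have "dfa_language (insert None (Some ` \<Sigma>)) N = padded_words L"
  proof -
    have "padded_words L \<subseteq> lists (insert None (Some ` \<Sigma>))"
      by (auto simp: padded_words_def M dfa_language_def)
    moreover have "foldl (trans N) (initial N) s \<in> accepting N \<longleftrightarrow> s \<in> padded_words L"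
      if "s \<in> lists (insert None (Some ` \<Sigma>))" for s
      using run[OF that, of "initial M"] by (simp add: M(2) dfa_language_def N_def)
    ultimately show ?thesis
      unfolding dfa_language_def by blast
  qed
  ultimately show ?thesis
    using regular_languageI by metis
qed

subsection \<open>Balanced ternary expansions\<close>

text \<open>Vectors are total functions that vanish off \<open>I\<close>, so that equality of
  vectors is equality of functions. Off \<open>I\<close> the value is 0 even if \<open>B\<close>
  does not contain 0, as for \<open>{1, -1}\<close>.\<close>

definition int_vectors :: "'i set \<Rightarrow> int set \<Rightarrow> ('i \<Rightarrow> int) set" where
  "int_vectors I B = {f. \<forall>x. (x \<in> I \<longrightarrow> f x \<in> B) \<and> (x \<notin> I \<longrightarrow> f x = 0)}"

lemma finite_int_vectors: "finite I \<Longrightarrow> finite B \<Longrightarrow> finite (int_vectors I B)"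
  unfolding int_vectors_def by (rule finite_set_of_finite_funs)

lemma int_vectors_mono: "B \<subseteq> C \<Longrightarrow> int_vectors I B \<subseteq> int_vectors I C"
  by (auto simp: int_vectors_def)

text \<open>The entries of \<open>g a\<close> may be any integers, not only digits: applying a
  linear map digit by digit makes them larger, but the value keeps its meaning.\<close>

fun ternary_value :: "('a \<Rightarrow> 'i \<Rightarrow> int) \<Rightarrow> 'a list \<Rightarrow> 'i \<Rightarrow> int" where
  "ternary_value g [] = (\<lambda>_. 0)"
| "ternary_value g (a # w) = (\<lambda>x. g a x + 3 * ternary_value g w x)"

lemma ternary_value_map: "ternary_value g (map h w) = ternary_value (g \<circ> h) w"
  by (induction w) simp_all

lemma ternary_value_append_zeros:
  "(\<And>a. a \<in> set v \<Longrightarrow> g a = (\<lambda>_. 0)) \<Longrightarrow> ternary_value g (w @ v) = ternary_value g w"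
  by (induction w, induction v) auto

lemma ternary_value_restrict:
  "ternary_value (\<lambda>a x. if x \<in> J then g a x else 0) w = (\<lambda>x. if x \<in> J then ternary_value g w x else 0)"
  by (induction w) auto

lemma ternary_value_diff:
  "ternary_value (\<lambda>a x. g a x - h a x) w = (\<lambda>x. ternary_value g w x - ternary_value h w x)"
  by (induction w) (auto simp: algebra_simps)

lemma ternary_value_in_int_vectors:
  assumes "\<And>a. a \<in> set w \<Longrightarrow> g a \<in> int_vectors I UNIV"
  shows "ternary_value g w \<in> int_vectors I UNIV"
  using assms by (induction w) (auto simp: int_vectors_def)

lemma finite_int_vectors_bounded:
  assumes "finite I" "finite F" "F \<subseteq> int_vectors I UNIV"
  obtains K where "F \<subseteq> int_vectors I {-K..K}"
proof -
  have "finite ((\<lambda>(f, x). \<bar>f x\<bar>) ` (F \<times> I))"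
    using assms by simp
  then obtain K where K: "\<forall>y \<in> (\<lambda>(f, x). \<bar>f x\<bar>) ` (F \<times> I). y \<le> K"
    using bdd_above_finite unfolding bdd_above_def by blast
  have "F \<subseteq> int_vectors I {-K..K}"
  proof
    fix f assume f: "f \<in> F"
    have "\<bar>f x\<bar> \<le> K" if "x \<in> I" for x
      using K f that by auto
    then show "f \<in> int_vectors I {-K..K}"
      using f assms(3) by (fastforce simp: int_vectors_def abs_le_iff)
  qed
  then show thesis ..
qed

text \<open>A state is the set of carries that are still possible; reading \<open>a\<close> replaces a carry \<open>c\<close> by
  \<open>(c + g a) / 3\<close> if this is integral and drops \<open>c\<close> otherwise, and an input is accepted if the carry
  \<open>0\<close> survives.\<close>

lemma regular_language_ternary_value:
  assumes \<Delta>: "finite \<Delta>" and I: "finite I"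
    and g: "\<And>a. a \<in> \<Delta> \<Longrightarrow> g a \<in> int_vectors I UNIV"
    and C: "finite C" "C \<subseteq> int_vectors I UNIV"
  shows "regular_language \<Delta> {s \<in> lists \<Delta>. ternary_value g s \<in> C}"
proof -
  have "finite (g ` \<Delta> \<union> C)" "g ` \<Delta> \<union> C \<subseteq> int_vectors I UNIV"
    using \<Delta> C g by (simp, intro Un_least image_subsetI)
  \<comment> \<open>One bound for the digits and the targets; it will also bound every
    carry.\<close>
  then obtain K where K: "g ` \<Delta> \<union> C \<subseteq> int_vectors I {-K..K}"
    by (rule finite_int_vectors_bounded[OF I])
  define Q where "Q = int_vectors I {-K..K}"
  define step where "step S a = {(\<lambda>x. (c x + g a x) div 3) | c. c \<in> S \<and> (\<forall>x. 3 dvd c x + g a x)}"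
    for S a
  \<comment> \<open>A target \<open>f\<close> starts as the carry \<open>- f\<close>, which reaches
    0 exactly if the input has value \<open>f\<close>. States are sets of carries because
    \<open>C\<close> may contain several targets. The condition \<open>S \<subseteq> Q\<close> makes
    accepting states belong to the state set.\<close>
  define M where "M = \<lparr>states = Pow Q, initial = (\<lambda>f x. - f x) ` C, trans = step,
    accepting = {S. S \<subseteq> Q \<and> (\<lambda>_. 0) \<in> S}\<rparr>"
  \<comment> \<open>Old carry and digit lie between \<open>-K\<close> and \<open>K\<close>, hence so
    does a third of their sum, even rounded down.\<close>
  have "step S a \<subseteq> Q" if "S \<subseteq> Q" "a \<in> \<Delta>" for S a
  proof
    fix f assume "f \<in> step S a"
    then obtain c where c: "c \<in> S" "f = (\<lambda>x. (c x + g a x) div 3)"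
      by (auto simp: step_def)
    moreover have "c \<in> Q" "g a \<in> Q"
      using c that K by (auto simp: Q_def)
    ultimately show "f \<in> Q"
      by (fastforce simp: Q_def int_vectors_def)
  qed
  moreover have "(\<lambda>f x. - f x) ` C \<subseteq> Q"
  proof (rule image_subsetI)
    fix f assume "f \<in> C"
    then have "f \<in> int_vectors I {-K..K}"
      using K by auto
    then show "(\<lambda>x. - f x) \<in> Q"
      by (force simp: Q_def int_vectors_def)
  qed
  moreover have "finite Q"
    using finite_int_vectors[OF I] by (simp add: Q_def)
  ultimately have M: "is_dfa \<Delta> M"
    using \<Delta> by (auto simp: is_dfa_def M_def)
  have run: "(\<lambda>_. 0) \<in> foldl step S s \<longleftrightarrow> (\<exists>c \<in> S. \<forall>x. c x + ternary_value g s x = 0)" for S s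
  proof (induction s arbitrary: S)
    case Nil
    have "(\<forall>x. c x + 0 = 0) \<longleftrightarrow> c = (\<lambda>_. 0)" for c :: "'b \<Rightarrow> int"
      by auto
    then show ?case
      by simp
  next
    case (Cons a s)
    \<comment> \<open>A carry that is dropped because 3 does not divide it could not have been
      completed to a zero sum, so nothing is lost.\<close>
    have div: "3 dvd y \<and> y div 3 + z = 0 \<longleftrightarrow> y + 3 * z = 0" for y z :: int
      by presburger
    have "(\<lambda>_. 0) \<in> foldl step S (a # s) \<longleftrightarrow>
        (\<exists>c \<in> step S a. \<forall>x. c x + ternary_value g s x = 0)"
      using Cons.IH by simp
    also have "\<dots> \<longleftrightarrow>
        (\<exists>c \<in> S. \<forall>x. 3 dvd c x + g a x \<and> (c x + g a x) div 3 + ternary_value g s x = 0)"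
      by (force simp: step_def)
    also have "\<dots> \<longleftrightarrow> (\<exists>c \<in> S. \<forall>x. c x + ternary_value g (a # s) x = 0)"
      by (simp only: div ternary_value.simps add.assoc)
    finally show ?case .
  qed
  have "foldl step (initial M) s \<in> accepting M \<longleftrightarrow> ternary_value g s \<in> C" if "s \<in> lists \<Delta>" for s
  proof -
    have "foldl step (initial M) s \<subseteq> Q"
      using foldl_in_states[OF M _ that, of "initial M"] M by (auto simp: is_dfa_def M_def)
    then have "foldl step (initial M) s \<in> accepting M \<longleftrightarrow> (\<lambda>_. 0) \<in> foldl step (initial M) s"
      by (simp add: M_def)
    also have "\<dots> \<longleftrightarrow> (\<exists>f \<in> C. f = ternary_value g s)"
    proof -
      have "(\<forall>x. - f x + ternary_value g s x = 0) \<longleftrightarrow> f = ternary_value g s" for f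
        by (auto simp: fun_eq_iff)
      then show ?thesis
        by (simp add: run M_def)
    qed
    finally show ?thesis
      by simp
  qed
  moreover have "trans M = step"
    by (simp add: M_def)
  ultimately have "dfa_language \<Delta> M = {s \<in> lists \<Delta>. ternary_value g s \<in> C}"
    by (auto simp: dfa_language_def)
  then show ?thesis
    using regular_languageI[OF M] by simp
qed

text \<open>The last letter is the most significant one. All entries share one word, so a single
  entry may have leading zeros; only a last letter whose digits are all zero is excluded.\<close>

definition canonical_words :: "'a set \<Rightarrow> ('a \<Rightarrow> 'i \<Rightarrow> int) \<Rightarrow> 'a list set" where
  "canonical_words \<Sigma> g = {w \<in> lists \<Sigma>. w = [] \<or> g (last w) \<noteq> (\<lambda>_. 0)}"

lemma regular_language_canonical_words:
  "finite \<Sigma> \<Longrightarrow> regular_language \<Sigma> (canonical_words \<Sigma> g)"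
  using regular_language_last[of \<Sigma> "{a. g a \<noteq> (\<lambda>_. 0)}"] by (simp add: canonical_words_def)

lemma canonical_words_ConsD:
  "a # w \<in> canonical_words \<Sigma> g \<Longrightarrow> a \<in> \<Sigma> \<and> w \<in> canonical_words \<Sigma> g"
  by (auto simp: canonical_words_def split: if_splits)

section \<open>Uniqueness and existence of expansions\<close>

lemma ternary_digit_unique:
  fixes d e y z :: int
  assumes "d + 3 * y = e + 3 * z" "d \<in> {-1, 0, 1}" "e \<in> {-1, 0, 1}"
  shows "d = e \<and> y = z"
proof -
  \<comment> \<open>The difference of the digits is a multiple of 3, so this bound makes it
    zero.\<close>
  have "\<bar>d - e\<bar> \<le> 2"
    using assms(2,3) by auto
  then show ?thesis
    using assms(1) by arith
qed

text \<open>Digit uniqueness in each coordinate. The right-hand side is a free pair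
  \<open>d\<close>, \<open>f\<close> instead of a second word, so that a word can also be compared
  with zero.\<close>

lemma ternary_value_Cons_eq:
  assumes g: "\<And>a. a \<in> \<Sigma> \<Longrightarrow> g a \<in> int_vectors I {-1, 0, 1}"
    and "a \<in> \<Sigma>" "d \<in> int_vectors I {-1, 0, 1}" "ternary_value g (a # w) = (\<lambda>x. d x + 3 * f x)"
  shows "g a = d \<and> ternary_value g w = f"
proof -
  have "g a x = d x \<and> ternary_value g w x = f x" for x
  proof (rule ternary_digit_unique)
    show "g a x + 3 * ternary_value g w x = d x + 3 * f x"
      using assms(4) by (auto dest: fun_cong)
  qed (use g[OF assms(2)] assms(3) in \<open>cases "x \<in> I"; auto simp: int_vectors_def\<close>)+
  then show ?thesis
    by auto
qed

text \<open>Value zero forces all digits to vanish, and then a nonempty word would end in a zero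
  letter.\<close>

lemma canonical_word_eq_Nil:
  assumes g: "\<And>a. a \<in> \<Sigma> \<Longrightarrow> g a \<in> int_vectors I {-1, 0, 1}"
  shows "w \<in> canonical_words \<Sigma> g \<Longrightarrow> ternary_value g w = (\<lambda>_. 0) \<Longrightarrow> w = []"
proof (induction w)
  case (Cons a w)
  have "a \<in> \<Sigma>" and w: "w \<in> canonical_words \<Sigma> g"
    using canonical_words_ConsD[OF Cons.prems(1)] by auto
  then have "g a = (\<lambda>_. 0) \<and> ternary_value g w = (\<lambda>_. 0)"
    using g Cons.prems(2) by (intro ternary_value_Cons_eq[of \<Sigma> g I]) (auto simp: int_vectors_def)
  with Cons w show ?case
    by (auto simp: canonical_words_def)
qed simp

lemma inj_on_ternary_value:
  assumes g: "\<And>a. a \<in> \<Sigma> \<Longrightarrow> g a \<in> int_vectors I {-1, 0, 1}" and inj: "inj_on g \<Sigma>"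
  shows "inj_on (ternary_value g) (canonical_words \<Sigma> g)"
proof (rule inj_onI)
  fix u v
  assume "u \<in> canonical_words \<Sigma> g" "v \<in> canonical_words \<Sigma> g" "ternary_value g u = ternary_value g v"
  then show "u = v"
  proof (induction u arbitrary: v)
    case Nil
    then show ?case
      using canonical_word_eq_Nil[of \<Sigma> g I v] g by simp
  next
    case (Cons a u)
    note IH = Cons.IH
    show ?case
    proof (cases v)
      case Nil
      then show ?thesis
        using canonical_word_eq_Nil[of \<Sigma> g I "a # u"] g Cons.prems by simp
    next
      case v: (Cons b w)
      have a: "a \<in> \<Sigma>" "u \<in> canonical_words \<Sigma> g" and b: "b \<in> \<Sigma>" "w \<in> canonical_words \<Sigma> g"
        using canonical_words_ConsD[OF Cons.prems(1)] canonical_words_ConsD[OF Cons.prems(2)[unfolded v]]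
        by simp_all
      then have "g a = g b \<and> ternary_value g u = ternary_value g w"
        using Cons.prems(3) v g by (intro ternary_value_Cons_eq[of \<Sigma> g I]) auto
      then show ?thesis
        using a b IH[of w] inj_onD[OF inj] v by simp
    qed
  qed
qed

lemma ternary_digit_exists:
  fixes z :: int
  obtains d q where "z = d + 3 * q" "d \<in> {-1, 0, 1}" "\<bar>q\<bar> \<le> \<bar>z\<bar>" "z \<noteq> 0 \<Longrightarrow> \<bar>q\<bar> < \<bar>z\<bar>"
proof
  \<comment> \<open>Shifting by 1 turns the residues 0, 1, 2 into the digits -1, 0, 1; the quotient
    is \<open>z / 3\<close> rounded to the nearest integer.\<close>
  show "z = ((z + 1) mod 3 - 1) + 3 * ((z + 1) div 3)"
    by presburger
  have "(z + 1) mod 3 = 0 \<or> (z + 1) mod 3 = 1 \<or> (z + 1) mod 3 = 2"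
    by presburger
  then show "(z + 1) mod 3 - 1 \<in> {-1, 0, 1}"
    by auto
  show "\<bar>(z + 1) div 3\<bar> \<le> \<bar>z\<bar>" "z \<noteq> 0 \<Longrightarrow> \<bar>(z + 1) div 3\<bar> < \<bar>z\<bar>"
    by arith+
qed

text \<open>Splitting off the lowest digits shrinks every nonzero entry and keeps zero entries, so
  the sum of absolute values drops. Balanced digits bring negative entries to 0 as well; with digits
  0, 1, 2 the entry -1 would reproduce itself.\<close>

lemma ternary_value_surj:
  assumes I: "finite I" and g: "g ` \<Sigma> = int_vectors I {-1, 0, 1}"
  shows "f \<in> int_vectors I UNIV \<Longrightarrow> f \<in> ternary_value g ` canonical_words \<Sigma> g"
proof (induction "\<Sum>x\<in>I. nat \<bar>f x\<bar>" arbitrary: f rule: less_induct)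
  case less
  show ?case
  proof (cases "f = (\<lambda>_. 0)")
    case True
    then have "f = ternary_value g []" "[] \<in> canonical_words \<Sigma> g"
      by (auto simp: canonical_words_def)
    then show ?thesis
      by blast
  next
    case False
    have "\<forall>x. \<exists>d q. f x = d + 3 * q \<and> d \<in> {-1, 0, 1} \<and> \<bar>q\<bar> \<le> \<bar>f x\<bar> \<and> (f x \<noteq> 0 \<longrightarrow> \<bar>q\<bar> < \<bar>f x\<bar>)"
      by (metis ternary_digit_exists)
    then obtain d q where dq: "\<And>x. f x = d x + 3 * q x" "\<And>x. d x \<in> {-1, 0, 1}"
      "\<And>x. \<bar>q x\<bar> \<le> \<bar>f x\<bar>" "\<And>x. f x \<noteq> 0 \<Longrightarrow> \<bar>q x\<bar> < \<bar>f x\<bar>"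
      by metis
    have f0: "f x = 0" if "x \<notin> I" for x
      using less.prems that by (auto simp: int_vectors_def)
    have q0: "q x = 0" if "x \<notin> I" for x
      using dq(3)[of x] f0[OF that] by simp
    have d: "d \<in> int_vectors I {-1, 0, 1}"
      using dq(1,2) f0 q0 by (auto simp: int_vectors_def)
    obtain y where y: "f y \<noteq> 0"
      using False by auto
    have "(\<Sum>x\<in>I. nat \<bar>q x\<bar>) < (\<Sum>x\<in>I. nat \<bar>f x\<bar>)"
    proof (rule sum_strict_mono_ex1[OF I])
      show "\<forall>x\<in>I. nat \<bar>q x\<bar> \<le> nat \<bar>f x\<bar>"
        using dq(3) by (simp add: nat_mono)
      show "\<exists>x\<in>I. nat \<bar>q x\<bar> < nat \<bar>f x\<bar>"
        using y f0 dq(4)[of y] by (intro bexI[of _ y]) auto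
    qed
    moreover have "q \<in> int_vectors I UNIV"
      using q0 by (auto simp: int_vectors_def)
    ultimately obtain w where w: "w \<in> canonical_words \<Sigma> g" "q = ternary_value g w"
      using less.hyps by blast
    obtain a where a: "a \<in> \<Sigma>" "g a = d"
      using d g by (metis imageE)
    \<comment> \<open>Canonicity could fail only if \<open>a\<close> becomes the last letter; then
      \<open>f = d\<close>, which is nonzero at \<open>y\<close>.\<close>
    have "d y \<noteq> 0" if "w = []"
      using that y dq(1)[of y] w by simp
    then have "a # w \<in> canonical_words \<Sigma> g"
      using a w by (auto simp: canonical_words_def)
    moreover have "f = ternary_value g (a # w)"
      using dq(1) a w by auto
    ultimately show ?thesis
      by blast
  qed
qed

lemma bij_betw_ternary_value:
  assumes I: "finite I" and g: "bij_betw g \<Sigma> (int_vectors I {-1, 0, 1})"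
  shows "bij_betw (ternary_value g) (canonical_words \<Sigma> g) (int_vectors I UNIV)"
proof -
  have g': "g a \<in> int_vectors I {-1, 0, 1}" if "a \<in> \<Sigma>" for a
    using g that by (auto simp: bij_betw_def)
  have "ternary_value g w \<in> int_vectors I UNIV" if "w \<in> canonical_words \<Sigma> g" for w
    using that g' int_vectors_mono[of "{-1, 0, 1}" UNIV I]
    by (intro ternary_value_in_int_vectors) (auto simp: canonical_words_def)
  then show ?thesis
    using inj_on_ternary_value[of \<Sigma> g I] ternary_value_surj[OF I, of g \<Sigma>] g g'
    by (fastforce simp: bij_betw_def)
qed

subsection \<open>Relations between words\<close>

lemma convolution_pair:
  "convolution [u, v] =
     map (\<lambda>k. [padded_symbol k u, padded_symbol k v]) [0..<max (length u) (length v)]"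
  by (simp add: convolution_def)

lemma map_Some_append_None_iff:
  "t = map Some u @ replicate k None \<longleftrightarrow>
     length t = length u + k \<and> (\<forall>j < length t. t ! j = padded_symbol j u)"
  by (auto simp: list_eq_iff_nth_eq nth_append padded_symbol_def)

text \<open>Splits being a convolution into conditions that automata can check: each track is a
  padded word, and no column consists of padding alone. The latter forbids excess length.\<close>

lemma eq_convolution_pair_iff:
  assumes s: "\<forall>x \<in> set s. length x = 2"
  shows "s = convolution [u, v] \<longleftrightarrow>
    (\<exists>k. map (\<lambda>x. x ! 0) s = map Some u @ replicate k None) \<and>
    (\<exists>k. map (\<lambda>x. x ! 1) s = map Some v @ replicate k None) \<and> [None, None] \<notin> set s"
proof
  assume s: "s = convolution [u, v]"
  have "[None, None] \<notin> set s"
    by (auto simp: s convolution_pair padded_symbol_def split: if_splits)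
  moreover have "map (\<lambda>x. x ! 0) s = map Some u @ replicate (length s - length u) None"
    "map (\<lambda>x. x ! 1) s = map Some v @ replicate (length s - length v) None"
    unfolding map_Some_append_None_iff by (auto simp: s convolution_pair)
  ultimately show "(\<exists>k. map (\<lambda>x. x ! 0) s = map Some u @ replicate k None) \<and>
    (\<exists>k. map (\<lambda>x. x ! 1) s = map Some v @ replicate k None) \<and> [None, None] \<notin> set s"
    by blast
next
  assume "(\<exists>k. map (\<lambda>x. x ! 0) s = map Some u @ replicate k None) \<and>
    (\<exists>k. map (\<lambda>x. x ! 1) s = map Some v @ replicate k None) \<and> [None, None] \<notin> set s"
  then obtain k l where
    k: "length s = length u + k" "\<And>j. j < length s \<Longrightarrow> s ! j ! 0 = padded_symbol j u" and
    l: "length s = length v + l" "\<And>j. j < length s \<Longrightarrow> s ! j ! 1 = padded_symbol j v" and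
    None: "[None, None] \<notin> set s"
    unfolding map_Some_append_None_iff by auto
  have nth: "s ! j = [padded_symbol j u, padded_symbol j v]" if "j < length s" for j
  proof -
    have "length (s ! j) = 2"
      using s that by simp
    then have "s ! j = [s ! j ! 0, s ! j ! 1]"
      by (auto simp: length_Suc_conv numeral_2_eq_2)
    then show ?thesis
      using k(2) l(2) that by simp
  qed
  \<comment> \<open>If both tracks ended in padding, the last column would be
    \<open>[None, None]\<close>.\<close>
  have "k = 0 \<or> l = 0"
  proof (rule ccontr)
    assume "\<not> (k = 0 \<or> l = 0)"
    then have "length u < length s" "length v < length s"
      using k(1) l(1) by auto
    then have "s ! (length s - 1) = [None, None]" "length s - 1 < length s"
      using nth[of "length s - 1"] by (auto simp: padded_symbol_def)
    then show False
      using None nth_mem by metis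
  qed
  then have "length s = max (length u) (length v)"
    using k(1) l(1) by auto
  then show "s = convolution [u, v]"
    using nth by (auto simp: convolution_pair intro: nth_equalityI)
qed

lemma finite_convolution_alphabet: "finite \<Sigma> \<Longrightarrow> finite (convolution_alphabet \<Sigma> n)"
  using finite_lists_length_eq[of "insert None (Some ` \<Sigma>)" n]
  by (simp add: convolution_alphabet_def conj_commute)

lemma convolution_pair_in_lists:
  assumes "u \<in> lists \<Sigma>" "v \<in> lists \<Sigma>"
  shows "convolution [u, v] \<in> lists (convolution_alphabet \<Sigma> 2)"
  using assms by (auto simp: convolution_pair convolution_alphabet_def padded_symbol_def)

lemma regular_language_subset_lists: "regular_language \<Sigma> L \<Longrightarrow> L \<subseteq> lists \<Sigma>"
  by (auto simp: regular_language_def dfa_language_def)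

text \<open>Being the convolution of two words of \<open>R\<close> is already regular, so only an
  automaton for \<open>P\<close> remains to be supplied.\<close>

lemma fa_recognizable_pairs:
  assumes R: "regular_language \<Sigma> R"
    and P: "regular_language (convolution_alphabet \<Sigma> 2) {s \<in> lists (convolution_alphabet \<Sigma> 2). P s}"
  shows "fa_recognizable \<Sigma> 2 {[u, v] | u v. u \<in> R \<and> v \<in> R \<and> P (convolution [u, v])}"
proof -
  define \<Delta> where "\<Delta> = convolution_alphabet \<Sigma> 2"
  define T where "T i = {s \<in> lists \<Delta>. map (\<lambda>x. x ! i) s \<in> padded_words R}" for i
  define N where "N = lists (\<Delta> \<inter> - {[None, None]})"
  have "finite \<Sigma>"
    using R by (auto simp: regular_language_def is_dfa_def)
  then have fin: "finite \<Delta>"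
    by (simp add: \<Delta>_def finite_convolution_alphabet)
  have R_lists: "R \<subseteq> lists \<Sigma>"
    using R by (rule regular_language_subset_lists)
  have T: "regular_language \<Delta> (T i)" if "i < 2" for i
    unfolding T_def
  proof (rule regular_language_vimage_map[OF regular_language_padded_words[OF R] fin])
    show "(\<lambda>x. x ! i) ` \<Delta> \<subseteq> insert None (Some ` \<Sigma>)"
    proof (rule image_subsetI)
      fix x assume "x \<in> \<Delta>"
      then have "length x = 2" "set x \<subseteq> insert None (Some ` \<Sigma>)"
        by (simp_all add: \<Delta>_def convolution_alphabet_def)
      then show "x ! i \<in> insert None (Some ` \<Sigma>)"
        using that nth_mem[of i x] by (metis subsetD)
    qed
  qed
  have "convolution ` {[u, v] | u v. u \<in> R \<and> v \<in> R \<and> P (convolution [u, v])} =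
      T 0 \<inter> T 1 \<inter> N \<inter> {s \<in> lists \<Delta>. P s}" (is "?L = ?R")
  proof -
    have on_lists: "s \<in> ?L \<longleftrightarrow> s \<in> ?R" if s: "s \<in> lists \<Delta>" for s
    proof -
      have "\<forall>x \<in> set s. length x = 2"
        using s by (auto simp: \<Delta>_def convolution_alphabet_def)
      note eq = eq_convolution_pair_iff[OF this]
      have "s \<in> ?L \<longleftrightarrow> (\<exists>u v. u \<in> R \<and> v \<in> R \<and> P s \<and> s = convolution [u, v])"
        by blast
      also have "\<dots> \<longleftrightarrow> s \<in> ?R"
        using s unfolding eq T_def padded_words_def N_def by auto
      finally show ?thesis .
    qed
    have L_lists: "s \<in> lists \<Delta>" if "s \<in> ?L" for s
    proof -
      from that obtain u v where "u \<in> R" "v \<in> R" "s = convolution [u, v]"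
        by auto
      then show ?thesis
        unfolding \<Delta>_def using R_lists convolution_pair_in_lists by (metis subsetD)
    qed
    have D_lists: "s \<in> lists \<Delta>" if "s \<in> ?R" for s
      using that by simp
    show ?thesis
    proof (intro equalityI subsetI)
      show "s \<in> ?R" if "s \<in> ?L" for s
        using on_lists[OF L_lists[OF that]] that by (rule iffD1)
      show "s \<in> ?L" if "s \<in> ?R" for s
        using on_lists[OF D_lists[OF that]] that by (rule iffD2)
    qed
  qed
  moreover have "regular_language \<Delta> (T 0 \<inter> T 1 \<inter> N \<inter> {s \<in> lists \<Delta>. P s})"
    using P T fin unfolding N_def \<Delta>_def
    by (intro regular_language_Int regular_language_lists) auto
  ultimately show ?thesis
    using R_lists unfolding fa_recognizable_def \<Delta>_def by auto
qed

text \<open>The second assumption is compatibility with one step of the recursion, so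
  \<open>T\<close> can be applied to each digit vector separately.\<close>

lemma ternary_value_linear:
  assumes "T (\<lambda>_. 0) = (\<lambda>_. 0)"
    and "\<And>f h. T (\<lambda>x. f x + 3 * h x) = (\<lambda>x. T f x + 3 * T h x)"
  shows "ternary_value (\<lambda>a. T (g a)) w = T (ternary_value g w)"
  by (induction w) (simp_all add: assms)

text \<open>Padding read as the digit 0 only adds leading zeros, which is why words of different
  lengths can be compared.\<close>

lemma ternary_value_padded:
  "ternary_value (case_option (\<lambda>_. 0) g) (map Some u @ replicate k None) = ternary_value g u"
proof -
  have "ternary_value (case_option (\<lambda>_. 0) g) (map Some u @ replicate k None) =
      ternary_value (case_option (\<lambda>_. 0) g) (map Some u)"
    by (rule ternary_value_append_zeros) simp
  also have "\<dots> = ternary_value g u"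
    by (simp add: ternary_value_map comp_def)
  finally show ?thesis .
qed

text \<open>The vector \<open>T (ternary_value g u) - ternary_value g v\<close> is itself the
  ternary value of the convolution, with \<open>h\<close> giving the contribution of a column. The
  relation says that it vanishes, which the carry automaton with the single target 0
  decides.\<close>

lemma fa_recognizable_ternary_linear:
  fixes T :: "('i \<Rightarrow> int) \<Rightarrow> 'i \<Rightarrow> int"
  assumes I: "finite I" and R: "regular_language \<Sigma> R"
    and g: "\<And>a. a \<in> \<Sigma> \<Longrightarrow> g a \<in> int_vectors I UNIV"
    and T: "\<And>f. T f \<in> int_vectors I UNIV"
    and T0: "T (\<lambda>_. 0) = (\<lambda>_. 0)"
    and T_add: "\<And>f h. T (\<lambda>x. f x + 3 * h x) = (\<lambda>x. T f x + 3 * T h x)"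
  shows "fa_recognizable \<Sigma> 2
    {[u, v] | u v. u \<in> R \<and> v \<in> R \<and> T (ternary_value g u) = ternary_value g v}"
proof -
  define \<Delta> where "\<Delta> = convolution_alphabet \<Sigma> 2"
  define g' where "g' = case_option (\<lambda>_. 0) g"
  define h where "h a = (\<lambda>x. T (g' (a ! 0)) x - g' (a ! 1) x)" for a
  have "finite \<Sigma>"
    using R by (auto simp: regular_language_def is_dfa_def)
  then have fin: "finite \<Delta>"
    by (simp add: \<Delta>_def finite_convolution_alphabet)
  have h_vec: "h a \<in> int_vectors I UNIV" if "a \<in> \<Delta>" for a
  proof -
    have "length a = 2" "set a \<subseteq> insert None (Some ` \<Sigma>)"
      using that by (simp_all add: \<Delta>_def convolution_alphabet_def)
    then have "a ! 1 \<in> insert None (Some ` \<Sigma>)"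
      using nth_mem[of 1 a] by (metis one_less_numeral_iff semiring_norm(76) subsetD)
    then have "g' (a ! 1) \<in> int_vectors I UNIV"
      using g by (auto simp: g'_def int_vectors_def)
    then show ?thesis
      using T[of "g' (a ! 0)"] by (simp add: h_def int_vectors_def)
  qed
  have "regular_language \<Delta> {s \<in> lists \<Delta>. ternary_value h s \<in> {\<lambda>_. 0}}"
    by (rule regular_language_ternary_value[OF fin I h_vec]) (auto simp: int_vectors_def)
  then have "fa_recognizable \<Sigma> 2
      {[u, v] | u v. u \<in> R \<and> v \<in> R \<and> ternary_value h (convolution [u, v]) \<in> {\<lambda>_. 0}}"
    unfolding \<Delta>_def by (rule fa_recognizable_pairs[OF R])
  moreover have "ternary_value h (convolution [u, v]) \<in> {\<lambda>_. 0} \<longleftrightarrow>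
      T (ternary_value g u) = ternary_value g v" for u v
  proof -
    define s where "s = convolution [u, v]"
    have "\<forall>x \<in> set s. length x = 2"
      by (auto simp: s_def convolution_pair)
    from eq_convolution_pair_iff[OF this, of u v] obtain k l where
      k: "map (\<lambda>x. x ! 0) s = map Some u @ replicate k None" and
      l: "map (\<lambda>x. x ! 1) s = map Some v @ replicate l None"
      unfolding s_def by blast
    have track: "ternary_value (\<lambda>a. g' (a ! i)) s = ternary_value g' (map (\<lambda>x. x ! i) s)" for i
      by (simp add: ternary_value_map comp_def)
    have "ternary_value h s = (\<lambda>x. ternary_value (\<lambda>a. T (g' (a ! 0))) s x -
        ternary_value (\<lambda>a. g' (a ! 1)) s x)"
      unfolding h_def by (rule ternary_value_diff)
    moreover have "ternary_value (\<lambda>a. T (g' (a ! 0))) s = T (ternary_value (\<lambda>a. g' (a ! 0)) s)"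
      by (rule ternary_value_linear[of T, OF T0 T_add])
    moreover have "ternary_value (\<lambda>a. g' (a ! 0)) s = ternary_value g u"
      "ternary_value (\<lambda>a. g' (a ! 1)) s = ternary_value g v"
      unfolding track k l unfolding g'_def ternary_value_padded by (rule refl)+
    ultimately have "ternary_value h s = (\<lambda>x. T (ternary_value g u) x - ternary_value g v x)"
      by simp
    then show ?thesis
      by (auto simp: s_def fun_eq_iff)
  qed
  ultimately show ?thesis
    by simp
qed

subsection \<open>The group of invertible upper triangular matrices\<close>

text \<open>The units of the integers are 1 and -1, so this describes the carrier of the group by
  conditions on single entries, which automata can check.\<close>

definition signed_unitriangular :: "nat \<Rightarrow> int mat set" where
  "signed_unitriangular n =
     {A \<in> carrier_mat n n. upper_triangular A \<and> (\<forall>i<n. A $$ (i, i) \<in> {1, -1})}"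

lemma signed_unitriangularD:
  assumes "A \<in> signed_unitriangular n"
  shows "A \<in> carrier_mat n n" "j < i \<Longrightarrow> i < n \<Longrightarrow> A $$ (i, j) = 0"
    "i < n \<Longrightarrow> A $$ (i, i) \<in> {1, -1}"
  using assms by (auto simp: signed_unitriangular_def)

lemma signed_unitriangularI:
  assumes "A \<in> carrier_mat n n" "\<And>i j. j < i \<Longrightarrow> i < n \<Longrightarrow> A $$ (i, j) = 0"
    "\<And>i. i < n \<Longrightarrow> A $$ (i, i) \<in> {1, -1}"
  shows "A \<in> signed_unitriangular n"
  using assms by (auto simp: signed_unitriangular_def)

lemma index_mult_mat_sum:
  assumes "A \<in> carrier_mat n n" "B \<in> carrier_mat n n" "i < n" "j < n"
  shows "(A * B) $$ (i, j) = (\<Sum>k<n. A $$ (i, k) * B $$ (k, j))"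
  using assms by (auto simp: scalar_prod_def atLeast0LessThan intro!: sum.cong)

lemma signed_unitriangular_mult:
  assumes A: "A \<in> signed_unitriangular n" and B: "B \<in> signed_unitriangular n"
  shows "A * B \<in> signed_unitriangular n"
proof (rule signed_unitriangularI)
  note A' = signed_unitriangularD[OF A] and B' = signed_unitriangularD[OF B]
  show "A * B \<in> carrier_mat n n"
    using A'(1) B'(1) by simp
  show "(A * B) $$ (i, j) = 0" if "j < i" "i < n" for i j
  proof -
    have "A $$ (i, k) * B $$ (k, j) = 0" if "k < n" for k
      using A'(2)[of k i] B'(2)[of j k] \<open>j < i\<close> \<open>i < n\<close> that by (cases "k < i") auto
    then show ?thesis
      using that by (subst index_mult_mat_sum[OF A'(1) B'(1)]) (auto intro: sum.neutral)
  qed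
  show "(A * B) $$ (i, i) \<in> {1, -1}" if i: "i < n" for i
  proof -
    have "(A * B) $$ (i, i) = (\<Sum>k<n. A $$ (i, k) * B $$ (k, i))"
      using A'(1) B'(1) i i by (rule index_mult_mat_sum)
    also have "\<dots> = (\<Sum>k<n. if k = i then A $$ (i, i) * B $$ (i, i) else 0)"
    proof (rule sum.cong)
      show "A $$ (i, k) * B $$ (k, i) = (if k = i then A $$ (i, i) * B $$ (i, i) else 0)"
        if "k \<in> {..<n}" for k
        using A'(2)[of k i] B'(2)[of i k] i that by (cases k i rule: linorder_cases) auto
    qed simp
    also have "\<dots> = A $$ (i, i) * B $$ (i, i)"
      using i by simp
    finally have "(A * B) $$ (i, i) = A $$ (i, i) * B $$ (i, i)" .
    then show ?thesis
      using A'(3)[OF i] B'(3)[OF i] by (elim insertE) simp_all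
  qed
qed

lemma one_mat_in_signed_unitriangular: "1\<^sub>m n \<in> signed_unitriangular n"
  by (rule signed_unitriangularI) auto

lemma addrow_mat_in_signed_unitriangular:
  "i < j \<Longrightarrow> j < n \<Longrightarrow> addrow_mat n e i j \<in> signed_unitriangular n"
  by (rule signed_unitriangularI) auto

text \<open>Rows are cleared from the bottom up: all rows below \<open>i\<close> are already diagonal, so adding
  \<open>\<plusminus>\<close> row \<open>j\<close> to row \<open>i\<close> changes the entry \<open>(i, j)\<close> only, and by \<open>\<plusminus>1\<close>.\<close>

lemma signed_unitriangular_induct [consumes 1, case_names diag step]:
  assumes "A \<in> signed_unitriangular n"
    and diag: "\<And>A. A \<in> signed_unitriangular n \<Longrightarrow>
      (\<And>i j. i < j \<Longrightarrow> j < n \<Longrightarrow> A $$ (i, j) = 0) \<Longrightarrow> P A"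
    and step: "\<And>B i j e. B \<in> signed_unitriangular n \<Longrightarrow> P B \<Longrightarrow> i < j \<Longrightarrow> j < n \<Longrightarrow>
      e \<in> {1, -1} \<Longrightarrow> P (addrow_mat n e i j * B)"
  shows "P A"
  using assms(1)
proof (induction "\<Sum>p \<in> {(i, j). i < j \<and> j < n}. nat \<bar>A $$ p\<bar>" arbitrary: A rule: less_induct)
  case less
  note A = signed_unitriangularD[OF less.prems]
  define S where "S = {i. \<exists>j. i < j \<and> j < n \<and> A $$ (i, j) \<noteq> 0}"
  show ?case
  proof (cases "S = {}")
    case True
    then show ?thesis
      using less.prems by (intro diag) (auto simp: S_def)
  next
    case False
    have "finite S"
      by (rule finite_subset[of _ "{..<n}"]) (auto simp: S_def)
    \<comment> \<open>Row \<open>i\<close> is the lowest one with a nonzero entry right of the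
      diagonal, so row \<open>j\<close>, being below it, has only its diagonal entry.\<close>
    define i where "i = Max S"
    have "i \<in> S"
      using False \<open>finite S\<close> by (simp add: i_def)
    then obtain j where j: "i < j" "j < n" "A $$ (i, j) \<noteq> 0"
      by (auto simp: S_def)
    have "j \<notin> S"
      using j(1) Max_ge[OF \<open>finite S\<close>, of j] by (auto simp: i_def)
    then have row_j: "A $$ (j, l) = 0" if "l \<noteq> j" "l < n" for l
      using that A(2)[of l j] j(2) by (cases l j rule: linorder_cases) (auto simp: S_def)
    \<comment> \<open>As \<open>A $$ (j, j)\<close> is its own inverse, adding \<open>e\<close>
      times row \<open>j\<close> moves the entry at \<open>(i, j)\<close> one unit towards
      0.\<close>
    define e where "e = - sgn (A $$ (i, j)) * A $$ (j, j)"
    have e: "e \<in> {1, -1}" "- e \<in> {1, -1}"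
      using A(3)[OF j(2)] j(3) by (auto simp: e_def sgn_if)
    have e_mult: "e * A $$ (j, j) = - sgn (A $$ (i, j))"
      using A(3)[OF j(2)] by (auto simp: e_def)
    define B where "B = addrow_mat n e i j * A"
    have B: "B \<in> signed_unitriangular n"
      unfolding B_def using j less.prems
      by (intro signed_unitriangular_mult addrow_mat_in_signed_unitriangular) auto
    have B_index: "B $$ (k, l) = (if k = i \<and> l = j then A $$ (i, j) - sgn (A $$ (i, j)) else A $$ (k, l))"
      if "k < n" "l < n" for k l
    proof -
      have "B = addrow e i j A"
        unfolding B_def by (rule addrow_mat[OF A(1) j(2), symmetric])
      then show ?thesis
        using that A(1) row_j[of l] e_mult by auto
    qed
    have "(\<Sum>p \<in> {(i, j). i < j \<and> j < n}. nat \<bar>B $$ p\<bar>) < (\<Sum>p \<in> {(i, j). i < j \<and> j < n}. nat \<bar>A $$ p\<bar>)"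
    proof (rule sum_strict_mono_ex1)
      show "finite {(i, j). i < j \<and> j < n}"
        by (rule finite_subset[of _ "{..<n} \<times> {..<n}"]) auto
      show "\<forall>p \<in> {(i, j). i < j \<and> j < n}. nat \<bar>B $$ p\<bar> \<le> nat \<bar>A $$ p\<bar>"
        using j(3) by (auto simp: B_index sgn_if)
      show "\<exists>p \<in> {(i, j). i < j \<and> j < n}. nat \<bar>B $$ p\<bar> < nat \<bar>A $$ p\<bar>"
        using j by (intro bexI[of _ "(i, j)"]) (auto simp: B_index sgn_if)
    qed
    then have "P (addrow_mat n (- e) i j * B)"
      using less.hyps B j e by (intro step) auto
    \<comment> \<open>The opposite row operation recovers \<open>A\<close> from \<open>B\<close>,
      which gives \<open>A\<close> the form required by \<open>step\<close>.\<close>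
    moreover have "addrow_mat n (- e) i j * B = (addrow_mat n (- e) i j * addrow_mat n (- (- e)) i j) * A"
      unfolding B_def minus_minus using A(1) by (intro assoc_mult_mat[symmetric, of _ n n _ n _ n]) auto
    then have "addrow_mat n (- e) i j * B = A"
      using j A(1) by (simp only: addrow_mat_inv[of i n j "- e"] left_mult_one_mat)
    ultimately show ?thesis
      by simp
  qed
qed

text \<open>A diagonal matrix of signs is its own inverse, and each row operation is undone by the
  opposite one. Building the inverse this way keeps it inside the set.\<close>

lemma signed_unitriangular_left_inverse:
  "A \<in> signed_unitriangular n \<Longrightarrow> \<exists>B \<in> signed_unitriangular n. B * A = 1\<^sub>m n"
proof (induction rule: signed_unitriangular_induct)
  case (diag A)
  note A = signed_unitriangularD[OF diag(1)]
  have "A * A = 1\<^sub>m n"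
  proof (rule eq_matI)
    fix i j assume "i < dim_row (1\<^sub>m n)" "j < dim_col (1\<^sub>m n)"
    then have ij: "i < n" "j < n"
      by simp_all
    have "A $$ (i, k) * A $$ (k, j) = (if k = i then if i = j then 1 else 0 else 0)" if "k < n" for k
      using diag(2)[of i k] diag(2)[of k j] A(2)[of k i] A(2)[of j k] A(3)[of i] ij that
      by (cases k i rule: linorder_cases; cases k j rule: linorder_cases) auto
    then show "(A * A) $$ (i, j) = 1\<^sub>m n $$ (i, j)"
      using ij by (simp add: index_mult_mat_sum[OF A(1) A(1)])
  qed (use A(1) in auto)
  then show ?case
    using diag(1) by blast
next
  case (step B i j e)
  then obtain C where C: "C \<in> signed_unitriangular n" "C * B = 1\<^sub>m n"
    by blast
  define E where "E a = addrow_mat n a i j" for a :: int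
  have E: "E a \<in> signed_unitriangular n" for a
    unfolding E_def using step by (intro addrow_mat_in_signed_unitriangular)
  note carrier = signed_unitriangularD(1)[OF C(1)] signed_unitriangularD(1)[OF step(1)]
    signed_unitriangularD(1)[OF E]
  have "E (- e) * E e = 1\<^sub>m n"
    using step addrow_mat_inv[of i n j "- e"] by (simp add: E_def)
  have "(C * E (- e)) * (E e * B) = C * (E (- e) * E e) * B"
    using carrier(1,2) carrier(3)[of e] carrier(3)[of "- e"]
    by (simp add: assoc_mult_mat[of _ n n _ n _ n] mult_carrier_mat[of _ n n _ n])
  also have "\<dots> = 1\<^sub>m n"
    using carrier C(2) \<open>E (- e) * E e = 1\<^sub>m n\<close> by simp
  finally show ?case
    using signed_unitriangular_mult[OF C(1) E] unfolding E_def by blast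
qed

text \<open>In one direction, a left inverse of the left inverse of \<open>A\<close> must be
  \<open>A\<close> itself, so the inverse is two-sided. In the other, the determinant is a unit and
  the product of the diagonal entries, so each of them is a unit.\<close>

lemma carrier_upper_triangular_group:
  "carrier (upper_triangular_group n) = signed_unitriangular n"
proof -
  have "A \<in> signed_unitriangular n \<longleftrightarrow> upper_triangular A \<and> invertible_mat A"
    if A: "A \<in> carrier_mat n n" for A :: "int mat"
  proof
    assume A': "A \<in> signed_unitriangular n"
    obtain B where B: "B \<in> signed_unitriangular n" "B * A = 1\<^sub>m n"
      using signed_unitriangular_left_inverse[OF A'] by blast
    obtain C where C: "C \<in> signed_unitriangular n" "C * B = 1\<^sub>m n"
      using signed_unitriangular_left_inverse[OF B(1)] by blast
    note carrier = signed_unitriangularD(1)[OF B(1)] signed_unitriangularD(1)[OF C(1)]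
    have "C = C * (B * A)"
      using carrier B(2) by simp
    also have "\<dots> = C * B * A"
      using carrier A by (simp add: assoc_mult_mat[of _ n n _ n _ n])
    also have "\<dots> = A"
      using A C(2) by simp
    finally have "A * B = 1\<^sub>m n"
      using C(2) by simp
    then show "upper_triangular A \<and> invertible_mat A"
      using A A' B(2) carrier
      by (auto simp: invertible_mat_def inverts_mat_def signed_unitriangular_def)
  next
    assume A': "upper_triangular A \<and> invertible_mat A"
    then obtain B where B: "A * B = 1\<^sub>m n" "B * A = 1\<^sub>m (dim_row B)"
      using A by (auto simp: invertible_mat_def inverts_mat_def)
    \<comment> \<open>Invertibility does not state the dimensions of \<open>B\<close>; they are read
      off from the two products.\<close>
    have "dim_col (A * B) = n" "dim_col (B * A) = dim_row B"
      using B by simp_all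
    then have "B \<in> carrier_mat n n"
      using A by auto
    then have "det A * det B = 1"
      using A B(1) det_mult[of A n B] by simp
    then have unit: "det A dvd 1"
      by (metis dvdI)
    have "A $$ (i, i) \<in> {1, -1}" if "i < n" for i
    proof -
      have "A $$ (i, i) \<in> set (diag_mat A)"
        using A that by (auto simp: diag_mat_def)
      then have "A $$ (i, i) dvd prod_list (diag_mat A)"
        by (auto dest!: split_list)
      also have "\<dots> = det A"
        using A A' by (simp add: det_upper_triangular)
      finally have "A $$ (i, i) dvd 1"
        using unit by (rule dvd_trans)
      then show ?thesis
        by auto
    qed
    then show "A \<in> signed_unitriangular n"
      using A A' by (simp add: signed_unitriangular_def)
  qed
  then show ?thesis
    by (auto simp: upper_triangular_group_def signed_unitriangular_def)
qed

lemma mult_upper_triangular_group: "A \<otimes>\<^bsub>upper_triangular_group n\<^esub> B = A * B"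
  by (simp add: upper_triangular_group_def)

lemma one_upper_triangular_group: "\<one>\<^bsub>upper_triangular_group n\<^esub> = 1\<^sub>m n"
  by (simp add: upper_triangular_group_def)

lemma group_upper_triangular_group: "group (upper_triangular_group n)"
proof (rule groupI, unfold carrier_upper_triangular_group mult_upper_triangular_group
    one_upper_triangular_group)
  show "A * B * C = A * (B * C)"
    if "A \<in> signed_unitriangular n" "B \<in> signed_unitriangular n" "C \<in> signed_unitriangular n" for A B C
    using that[THEN signed_unitriangularD(1)] by (rule assoc_mult_mat)
  show "1\<^sub>m n * A = A" if "A \<in> signed_unitriangular n" for A
    using that[THEN signed_unitriangularD(1)] by simp
qed (use signed_unitriangular_mult one_mat_in_signed_unitriangular
    signed_unitriangular_left_inverse in auto)

section \<open>A finite generating set\<close>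

definition small_unitriangular :: "nat \<Rightarrow> int mat set" where
  "small_unitriangular n =
     {A \<in> signed_unitriangular n. \<forall>i<n. \<forall>j<n. A $$ (i, j) \<in> {-1, 0, 1}}"

lemma finite_small_unitriangular: "finite (small_unitriangular n)"
proof (rule finite_subset)
  show "small_unitriangular n \<subseteq> mat n n ` int_vectors ({..<n} \<times> {..<n}) {-1, 0, 1}"
  proof
    fix A assume A: "A \<in> small_unitriangular n"
    then have "A = mat n n (\<lambda>p. if p \<in> {..<n} \<times> {..<n} then A $$ p else 0)"
      by (intro eq_matI) (auto simp: small_unitriangular_def signed_unitriangular_def)
    moreover have "(\<lambda>p. if p \<in> {..<n} \<times> {..<n} then A $$ p else 0) \<in>
        int_vectors ({..<n} \<times> {..<n}) {-1, 0, 1}"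
      using A by (auto simp: int_vectors_def small_unitriangular_def)
    ultimately show "A \<in> mat n n ` int_vectors ({..<n} \<times> {..<n}) {-1, 0, 1}"
      by (rule image_eqI)
  qed
qed (simp add: finite_int_vectors)

text \<open>The generators include the diagonal matrices of signs and the elementary matrices with
  entry 1 or -1, which are the base case and the left factors in
  \<open>signed_unitriangular_induct\<close>.\<close>

lemma generate_small_unitriangular:
  "generate (upper_triangular_group n) (small_unitriangular n) = carrier (upper_triangular_group n)"
proof
  interpret group "upper_triangular_group n"
    by (rule group_upper_triangular_group)
  have "small_unitriangular n \<subseteq> carrier (upper_triangular_group n)"
    by (auto simp: small_unitriangular_def carrier_upper_triangular_group)
  then show "generate (upper_triangular_group n) (small_unitriangular n) \<subseteq>
      carrier (upper_triangular_group n)"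
    by (rule generate_incl)
  show "carrier (upper_triangular_group n) \<subseteq>
      generate (upper_triangular_group n) (small_unitriangular n)"
  proof
    fix A assume "A \<in> carrier (upper_triangular_group n)"
    then have "A \<in> signed_unitriangular n"
      by (simp add: carrier_upper_triangular_group)
    then show "A \<in> generate (upper_triangular_group n) (small_unitriangular n)"
    proof (induction rule: signed_unitriangular_induct)
      case (diag A)
      note A = signed_unitriangularD[OF diag(1)]
      have "A $$ (i, j) \<in> {-1, 0, 1}" if "i < n" "j < n" for i j
        using that diag(2)[of i j] A(2)[of j i] A(3)[of i] by (cases i j rule: linorder_cases) auto
      then show ?case
        using diag(1) by (intro generate.incl) (simp add: small_unitriangular_def)
    next
      case (step B i j e)
      have "addrow_mat n e i j \<in> small_unitriangular n"
        using step addrow_mat_in_signed_unitriangular[of i j n e]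
        by (auto simp: small_unitriangular_def)
      then show ?case
        using step generate.eng[OF generate.incl]
        by (metis mult_upper_triangular_group)
    qed
  qed
qed

text \<open>Only positions on or above the diagonal carry information; the witness puts 0 elsewhere,
  also at indices outside the matrix, as \<open>int_vectors\<close> demands.\<close>

lemma bij_betw_mat_signed_unitriangular:
  "bij_betw (mat n n) {f \<in> int_vectors {(i, j). i \<le> j \<and> j < n} UNIV. \<forall>i<n. f (i, i) \<in> {1, -1}}
     (signed_unitriangular n)"
proof (rule bij_betw_byWitness[where f' = "\<lambda>A (i, j). if i \<le> j \<and> j < n then A $$ (i, j) else 0"])
  show "\<forall>f \<in> {f \<in> int_vectors {(i, j). i \<le> j \<and> j < n} UNIV. \<forall>i<n. f (i, i) \<in> {1, -1}}.
      (\<lambda>(i, j). if i \<le> j \<and> j < n then mat n n f $$ (i, j) else 0) = f"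
    by (auto simp: int_vectors_def)
  show "\<forall>A \<in> signed_unitriangular n.
      mat n n (\<lambda>(i, j). if i \<le> j \<and> j < n then A $$ (i, j) else 0) = A"
  proof
    fix A assume "A \<in> signed_unitriangular n"
    note A = signed_unitriangularD[OF this]
    show "mat n n (\<lambda>(i, j). if i \<le> j \<and> j < n then A $$ (i, j) else 0) = A"
      using A(1,2) by (intro eq_matI) auto
  qed
  show "mat n n ` {f \<in> int_vectors {(i, j). i \<le> j \<and> j < n} UNIV. \<forall>i<n. f (i, i) \<in> {1, -1}} \<subseteq>
      signed_unitriangular n"
    by (intro image_subsetI signed_unitriangularI) (auto simp: int_vectors_def)
  show "(\<lambda>A (i, j). if i \<le> j \<and> j < n then A $$ (i, j) else 0) ` signed_unitriangular n \<subseteq>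
      {f \<in> int_vectors {(i, j). i \<le> j \<and> j < n} UNIV. \<forall>i<n. f (i, i) \<in> {1, -1}}"
    by (auto simp: int_vectors_def signed_unitriangular_def)
qed

section \<open>The graph automatic presentation\<close>

theorem proposition13p6:
  fixes n :: nat
  assumes "n > 0"
  shows "graph_automatic (upper_triangular_group n)"
proof -
  define I where "I = {(i, j). i \<le> j \<and> j < n}"
  define D where "D = {(i, i) | i. i < n}"
  have I: "finite I" and D: "finite D"
    by (auto simp: I_def D_def intro: finite_subset[of _ "{..<n} \<times> {..<n}"])
  \<comment> \<open>A letter is the number of a digit vector, that is, of a choice of one digit for
    every position in \<open>I\<close>.\<close>
  obtain \<Sigma> :: "nat set" and g where \<Sigma>: "finite \<Sigma>" and g: "bij_betw g \<Sigma> (int_vectors I {-1, 0, 1})"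
    using ex_bij_betw_nat_finite[OF finite_int_vectors[OF I, of "{-1, 0, 1}"]] by blast
  then have "g a \<in> int_vectors I {-1, 0, 1}" if "a \<in> \<Sigma>" for a
    using that by (auto simp: bij_betw_def)
  then have g_vec: "g a \<in> int_vectors I UNIV" if "a \<in> \<Sigma>" for a
    using that int_vectors_mono[of "{-1, 0, 1}" UNIV I] by blast
  define F where "F = {f \<in> int_vectors I UNIV. \<forall>i<n. f (i, i) \<in> {1, -1}}"
  define R where "R = {w \<in> canonical_words \<Sigma> g. ternary_value g w \<in> F}"
  define \<nu> where "\<nu> = (\<lambda>w. mat n n (ternary_value g w))"

  have val: "bij_betw (ternary_value g) (canonical_words \<Sigma> g) (int_vectors I UNIV)"
    using I g by (rule bij_betw_ternary_value)
  have val_R: "bij_betw (ternary_value g) R F"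
  proof (rule bij_betw_subset[OF val])
    show "ternary_value g ` R = F"
      using val by (auto simp: R_def F_def bij_betw_def image_iff)
  qed (auto simp: R_def)
  have mat: "bij_betw (mat n n) F (signed_unitriangular n)"
    unfolding F_def I_def by (rule bij_betw_mat_signed_unitriangular)
  have \<nu>: "bij_betw \<nu> R (signed_unitriangular n)"
    using bij_betw_trans[OF val_R mat] by (simp add: \<nu>_def comp_def)

  have R_reg: "regular_language \<Sigma> R"
  proof -
    \<comment> \<open>Keeping only the diagonal digits turns the condition on the diagonal into
      membership of the value in a finite set of sign vectors, so the carry automaton applies with
      several targets.\<close>
    define d where "d a = (\<lambda>x. if x \<in> D then g a x else 0)" for a
    have "regular_language \<Sigma> {w \<in> lists \<Sigma>. ternary_value d w \<in> int_vectors D {1, -1}}"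
    proof (rule regular_language_ternary_value[OF \<Sigma> D])
      show "d a \<in> int_vectors D UNIV" for a
        by (simp add: d_def int_vectors_def)
      show "finite (int_vectors D {1, -1})"
        using D by (simp add: finite_int_vectors)
      show "int_vectors D {1, -1} \<subseteq> int_vectors D UNIV"
        by (simp add: int_vectors_mono)
    qed
    moreover have "ternary_value d w \<in> int_vectors D {1, -1} \<longleftrightarrow>
        (\<forall>i<n. ternary_value g w (i, i) \<in> {1, -1})" for w
      unfolding d_def ternary_value_restrict by (auto simp: int_vectors_def D_def)
    ultimately have "regular_language \<Sigma> {w \<in> lists \<Sigma>. \<forall>i<n. ternary_value g w (i, i) \<in> {1, -1}}"
      by simp
    then have "regular_language \<Sigma>
        (canonical_words \<Sigma> g \<inter> {w \<in> lists \<Sigma>. \<forall>i<n. ternary_value g w (i, i) \<in> {1, -1}})"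
      by (rule regular_language_Int[OF regular_language_canonical_words[OF \<Sigma>]])
    moreover have "R = canonical_words \<Sigma> g \<inter> {w \<in> lists \<Sigma>. \<forall>i<n. ternary_value g w (i, i) \<in> {1, -1}}"
      using val by (auto simp: R_def F_def bij_betw_def canonical_words_def)
    ultimately show ?thesis
      by simp
  qed

  have rec: "fa_recognizable \<Sigma> 2 {[u, v] | u v. u \<in> R \<and> v \<in> R \<and> \<nu> u * X = \<nu> v}"
    if X: "X \<in> signed_unitriangular n" for X
  proof -
    \<comment> \<open>Right multiplication by \<open>X\<close> in coordinates, cut off to
      \<open>I\<close> so that the result is a vector on \<open>I\<close> for every
      \<open>f\<close>.\<close>
    define T where "T f = (\<lambda>(i, j). if (i, j) \<in> I then \<Sum>k<n. f (i, k) * X $$ (k, j) else 0)"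
      for f :: "nat \<times> nat \<Rightarrow> int"
    have T_vec: "T f \<in> int_vectors I UNIV" for f
      by (auto simp: T_def int_vectors_def)
    have "fa_recognizable \<Sigma> 2
        {[u, v] | u v. u \<in> R \<and> v \<in> R \<and> T (ternary_value g u) = ternary_value g v}"
      by (rule fa_recognizable_ternary_linear[OF I R_reg g_vec T_vec])
        (auto simp: T_def fun_eq_iff sum.distrib sum_distrib_left algebra_simps)
    moreover have "T (ternary_value g u) = ternary_value g v \<longleftrightarrow> \<nu> u * X = \<nu> v"
      if "u \<in> R" "v \<in> R" for u v
    proof -
      have prod: "\<nu> u * X \<in> signed_unitriangular n"
        using \<nu> X that by (intro signed_unitriangular_mult) (auto simp: bij_betw_def)
      have \<nu>_carrier: "\<nu> u \<in> carrier_mat n n"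
        by (simp add: \<nu>_def)
      have mat_T: "mat n n (T (ternary_value g u)) = \<nu> u * X"
      proof (rule eq_matI)
        fix i j assume "i < dim_row (\<nu> u * X)" "j < dim_col (\<nu> u * X)"
        then have ij: "i < n" "j < n"
          using signed_unitriangularD(1)[OF X] by (auto simp: \<nu>_def)
        show "mat n n (T (ternary_value g u)) $$ (i, j) = (\<nu> u * X) $$ (i, j)"
        proof (cases "i \<le> j")
          case True
          have "(\<nu> u * X) $$ (i, j) = (\<Sum>k<n. ternary_value g u (i, k) * X $$ (k, j))"
            using ij by (simp add: index_mult_mat_sum[OF \<nu>_carrier signed_unitriangularD(1)[OF X]])
              (simp add: \<nu>_def)
          then show ?thesis
            using ij True by (simp add: T_def I_def)
        next
          case False
          then show ?thesis
            using ij signed_unitriangularD(2)[OF prod, of j i] by (simp add: T_def I_def)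
        qed
      qed (use signed_unitriangularD(1)[OF X] in \<open>auto simp: \<nu>_def\<close>)
      \<comment> \<open>Both vectors have to lie in \<open>F\<close>, where \<open>mat n n\<close>
        is injective; equality of matrices then amounts to equality of vectors.\<close>
      have "T (ternary_value g u) (i, i) = (\<nu> u * X) $$ (i, i)" if "i < n" for i
        using that by (simp flip: mat_T)
      then have "T (ternary_value g u) \<in> F"
        using T_vec signed_unitriangularD(3)[OF prod] by (simp add: F_def)
      moreover have "ternary_value g v \<in> F"
        using that by (simp add: R_def)
      ultimately have "T (ternary_value g u) = ternary_value g v \<longleftrightarrow>
          mat n n (T (ternary_value g u)) = mat n n (ternary_value g v)"
        using mat by (auto simp: bij_betw_def inj_on_eq_iff)
      then show ?thesis
        by (simp add: mat_T \<nu>_def)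
    qed
    then have "{[u, v] | u v. u \<in> R \<and> v \<in> R \<and> T (ternary_value g u) = ternary_value g v} =
        {[u, v] | u v. u \<in> R \<and> v \<in> R \<and> \<nu> u * X = \<nu> v}"
      by blast
    ultimately show ?thesis
      by simp
  qed

  have small: "small_unitriangular n \<subseteq> signed_unitriangular n"
    by (auto simp: small_unitriangular_def)
  have "graph_automatic_wrt (upper_triangular_group n) (small_unitriangular n)"
    unfolding graph_automatic_wrt_def carrier_upper_triangular_group mult_upper_triangular_group
    using \<Sigma> R_reg \<nu> rec small by blast
  then show ?thesis
    unfolding graph_automatic_def
    using group_upper_triangular_group finite_small_unitriangular generate_small_unitriangular small
    by (metis carrier_upper_triangular_group)
qed

end
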